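(* Let $n\ge 2$, $2^{n-2}<k\le 2^{n-1}$, and let $H$ be a spanned hyperplane of $Q_n$ containing at least $k$ points of $V_n$. Then the number $N_H(k)$ of partial $0/1$-equivalence classes of $H$ with $k$ vertices equals $$N_H(k)=\left[u_1^k u_2^{|V_n(H)|-k}\right]C_H(u_1,u_2).$$
   Context: $Q_n=[0,1]^n$, $V_n=\{0,1\}^n$. A $0/1$-polytope of $Q_n$ is the convex hull of a nonempty subset of $V_n$; it has $k$ vertices if that subset has $k$ elements. $B_n$ is the group of signed permutations $w$ of $\{1,\dots,n\}$ (underlying permutation $\pi$, sign $\pm$ on each $i$), acting on $\mathbb{R}^n$ by $w(x)_i=x_{\pi(i)}$ if $i$ has sign $+$ and $w(x)_i=1-x_{\pi(i)}$ if $i$ has sign $-$. A spanned hyperplane of $Q_n$ is a hyperplane $H$ such that the affine hull of $H\cap V_n$ is $H$; $V_n(H)=H\cap V_n$. Partial $0/1$-equivalence classes of $H$: $0/1$-polytopes contained in $H$, two being equivalent iff some $w\in B_n$ maps one onto the other. $F(H)=\{w\in B_n: w(H)=H\}$, which permutes $V_n(H)$. For a finite group $G$ acting on a finite set $X$ and $g\in G$, if the induced permutation of $X$ has $c_i$ cycles of length $i$, write $z^{c(g)}=\prod_i z_i^{c_i}$; the cycle index is $Z_G(z)=\frac{1}{|G|}\sum_{g\in G}z^{c(g)}$. $Z_H(z)$ is the cycle index of $F(H)$ acting on $V_n(H)$, $C_H(u_1,u_2)$ is obtained from $Z_H(z)$ by substituting $z_i\mapsto u_1^i+u_2^i$, and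 $[u_1^pu_2^q]$ denotes the coefficient of $u_1^pu_2^q$. *)

theory Defs
  imports
    "HOL-Analysis.Analysis"
    "HOL-Algebra.Group_Action"
    "HOL-Combinatorics.Orbits"
    "HOL-Library.Poly_Mapping"
begin

section \<open>Signed permutations\<close>

text \<open>
  The coordinate indices form a finite type \<open>'n\<close>, so that \<open>n = CARD('n)\<close>. A signed permutation
  is a pair \<open>(\<pi>, s)\<close>, where \<open>s i\<close> holds iff \<open>i\<close> has sign \<open>+\<close>.
\<close>

type_synonym 'n signed_perm = "('n \<Rightarrow> 'n) \<times> ('n \<Rightarrow> bool)"

definition signed_act :: "'n signed_perm \<Rightarrow> real ^ 'n \<Rightarrow> real ^ 'n" where
  "signed_act w x = (\<chi> i. if snd w i then x $ fst w i else 1 - x $ fst w i)"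

text \<open>
  The product is chosen such that \<open>signed_act\<close> is a left action
  (\<open>signed_act_mult\<close> below); this reverses the composition of the underlying permutations.
\<close>

definition hyperoctahedral_group :: "('n::finite) signed_perm monoid" where
  "hyperoctahedral_group =
     \<lparr> carrier = {w. fst w permutes UNIV},
       mult = (\<lambda>v w. (fst w \<circ> fst v, \<lambda>i. snd v i \<longleftrightarrow> snd w (fst v i))),
       one = (id, \<lambda>_. True) \<rparr>"

lemma signed_act_one: "signed_act \<one>\<^bsub>hyperoctahedral_group\<^esub> x = x"
  by (simp add: signed_act_def hyperoctahedral_group_def vec_eq_iff)

lemma signed_act_mult:
  "signed_act (v \<otimes>\<^bsub>hyperoctahedral_group\<^esub> w) x = signed_act v (signed_act w x)"
  by (auto simp: signed_act_def hyperoctahedral_group_def vec_eq_iff)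

lemma group_hyperoctahedral_group: "group (hyperoctahedral_group :: ('n::finite) signed_perm monoid)"
proof (rule groupI)
  fix w :: "'n signed_perm"
  assume "w \<in> carrier hyperoctahedral_group"
  then have p: "fst w permutes UNIV"
    by (simp add: hyperoctahedral_group_def)
  let ?v = "(inv_into UNIV (fst w), \<lambda>i. snd w (inv_into UNIV (fst w) i)) :: 'n signed_perm"
  have "?v \<in> carrier hyperoctahedral_group"
    using p by (simp add: hyperoctahedral_group_def permutes_inv)
  moreover have "?v \<otimes>\<^bsub>hyperoctahedral_group\<^esub> w = \<one>\<^bsub>hyperoctahedral_group\<^esub>"
    using p by (simp add: hyperoctahedral_group_def permutes_inv_o)
  ultimately show "\<exists>v \<in> carrier hyperoctahedral_group.
      v \<otimes>\<^bsub>hyperoctahedral_group\<^esub> w = \<one>\<^bsub>hyperoctahedral_group\<^esub>"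
    by blast
qed (auto simp: hyperoctahedral_group_def permutes_compose o_assoc permutes_id)


section \<open>Cube vertices, 0/1-polytopes and spanned hyperplanes\<close>

definition cube_vertices :: "(real ^ 'n) set" where
  "cube_vertices = {x. \<forall>i. x $ i \<in> {0, 1}}"

definition vertices_in :: "(real ^ 'n) set \<Rightarrow> (real ^ 'n) set" where
  "vertices_in H = H \<inter> cube_vertices"

definition zero_one_polytope :: "(real ^ 'n) set \<Rightarrow> bool" where
  "zero_one_polytope P \<longleftrightarrow> (\<exists>S. S \<noteq> {} \<and> S \<subseteq> cube_vertices \<and> P = convex hull S)"

definition zero_one_polytope_with :: "nat \<Rightarrow> (real ^ 'n) set \<Rightarrow> bool" where
  "zero_one_polytope_with k P \<longleftrightarrow>
     (\<exists>S. S \<noteq> {} \<and> S \<subseteq> cube_vertices \<and> card S = k \<and> P = convex hull S)"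

definition spanned_hyperplane :: "(real ^ 'n) set \<Rightarrow> bool" where
  "spanned_hyperplane H \<longleftrightarrow>
     (\<exists>a b. a \<noteq> 0 \<and> H = {x. a \<bullet> x = b}) \<and> affine hull (vertices_in H) = H"


section \<open>Partial 0/1-equivalence classes\<close>

definition polytopes_in :: "(real ^ 'n) set \<Rightarrow> (real ^ 'n) set set" where
  "polytopes_in H = {P. zero_one_polytope P \<and> P \<subseteq> H}"

definition zero_one_equiv :: "(real ^ 'n::finite) set \<Rightarrow> ((real ^ 'n) set \<times> (real ^ 'n) set) set" where
  "zero_one_equiv H =
     {(P, Q). P \<in> polytopes_in H \<and> Q \<in> polytopes_in H \<and>
              (\<exists>w \<in> carrier hyperoctahedral_group. signed_act w ` P = Q)}"

definition partial_classes :: "(real ^ 'n::finite) set \<Rightarrow> (real ^ 'n) set set set" where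
  "partial_classes H = polytopes_in H // zero_one_equiv H"

definition num_partial_classes :: "(real ^ 'n::finite) set \<Rightarrow> nat \<Rightarrow> nat" where
  "num_partial_classes H k =
     card {C \<in> partial_classes H. \<forall>P \<in> C. zero_one_polytope_with k P}"

lemma signed_act_inv:
  fixes w :: "('n::finite) signed_perm"
  assumes "w \<in> carrier hyperoctahedral_group"
  shows "signed_act (inv\<^bsub>hyperoctahedral_group\<^esub> w) (signed_act w x) = x"
    and "signed_act w (signed_act (inv\<^bsub>hyperoctahedral_group\<^esub> w) x) = x"
proof -
  interpret group "hyperoctahedral_group :: 'n signed_perm monoid"
    by (rule group_hyperoctahedral_group)
  show "signed_act (inv\<^bsub>hyperoctahedral_group\<^esub> w) (signed_act w x) = x"
    "signed_act w (signed_act (inv\<^bsub>hyperoctahedral_group\<^esub> w) x) = x"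
    using assms by (simp_all flip: signed_act_mult add: signed_act_one)
qed

lemma equiv_zero_one_equiv: "equiv (polytopes_in H) (zero_one_equiv (H :: (real ^ 'n::finite) set))"
proof -
  interpret group "hyperoctahedral_group :: 'n signed_perm monoid"
    by (rule group_hyperoctahedral_group)
  show ?thesis
  proof (rule equivI)
    show "refl_on (polytopes_in H) (zero_one_equiv H)"
      by (rule refl_onI)
         (auto simp: zero_one_equiv_def signed_act_one intro!: bexI[OF _ one_closed])
    show "sym (zero_one_equiv H)"
      by (rule symI)
         (auto simp: zero_one_equiv_def image_image signed_act_inv intro!: bexI[OF _ inv_closed])
    show "trans (zero_one_equiv H)"
    proof (rule transI)
      fix P Q R assume "(P, Q) \<in> zero_one_equiv H" "(Q, R) \<in> zero_one_equiv H"
      then obtain v w where "P \<in> polytopes_in H" "R \<in> polytopes_in H"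
        "v \<in> carrier hyperoctahedral_group" "signed_act v ` P = Q"
        "w \<in> carrier hyperoctahedral_group" "signed_act w ` Q = R"
        by (auto simp: zero_one_equiv_def)
      moreover from this have "signed_act (w \<otimes>\<^bsub>hyperoctahedral_group\<^esub> v) ` P = R"
        by (auto simp: signed_act_mult image_image)
      ultimately show "(P, R) \<in> zero_one_equiv H"
        by (auto simp: zero_one_equiv_def)
    qed
  qed (auto simp: zero_one_equiv_def)
qed


section \<open>Cycle index\<close>

text \<open>
  Polynomials over the rationals in indeterminates indexed by the natural numbers: finitely
  supported functions from monomials to coefficients, with a monomial being a finitely supported
  function from indices to exponents.
\<close>

type_synonym rat_mpoly = "(nat \<Rightarrow>\<^sub>0 nat) \<Rightarrow>\<^sub>0 rat"

definition mpoly_var :: "nat \<Rightarrow> rat_mpoly" where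
  "mpoly_var i = Poly_Mapping.single (Poly_Mapping.single i 1) 1"

definition mpoly_const :: "rat \<Rightarrow> rat_mpoly" where
  "mpoly_const c = Poly_Mapping.single 0 c"

definition mpoly_subst :: "(nat \<Rightarrow> rat_mpoly) \<Rightarrow> rat_mpoly \<Rightarrow> rat_mpoly" where
  "mpoly_subst \<sigma> p =
     (\<Sum>m \<in> Poly_Mapping.keys p. mpoly_const (Poly_Mapping.lookup p m) *
        (\<Prod>i \<in> Poly_Mapping.keys m. \<sigma> i ^ Poly_Mapping.lookup m i))"

text \<open>
  For a permutation \<open>f\<close> of a finite set \<open>X\<close>, the sets \<^term>\<open>Orbits.orbit f x\<close> with \<open>x \<in> X\<close> are
  the cycles of \<open>f\<close> on \<open>X\<close>, fixed points included.
\<close>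

definition num_cycles :: "('x \<Rightarrow> 'x) \<Rightarrow> 'x set \<Rightarrow> nat \<Rightarrow> nat" where
  "num_cycles f X i = card {c \<in> Orbits.orbit f ` X. card c = i}"

definition cycle_monomial :: "('x \<Rightarrow> 'x) \<Rightarrow> 'x set \<Rightarrow> rat_mpoly" where
  "cycle_monomial f X = (\<Prod>i = 1..card X. mpoly_var i ^ num_cycles f X i)"

definition cycle_index :: "('g, 'b) monoid_scheme \<Rightarrow> 'x set \<Rightarrow> ('g \<Rightarrow> 'x \<Rightarrow> 'x) \<Rightarrow> rat_mpoly" where
  "cycle_index G X \<phi> =
     mpoly_const (1 / of_nat (card (carrier G))) * (\<Sum>g \<in> carrier G. cycle_monomial (\<phi> g) X)"


section \<open>The cycle index of a hyperplane\<close>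

definition hyperplane_group :: "(real ^ 'n::finite) set \<Rightarrow> 'n signed_perm monoid" where
  "hyperplane_group H = hyperoctahedral_group
     \<lparr> carrier := {w \<in> carrier hyperoctahedral_group. signed_act w ` H = H} \<rparr>"

definition vertex_act :: "(real ^ 'n::finite) set \<Rightarrow> 'n signed_perm \<Rightarrow> real ^ 'n \<Rightarrow> real ^ 'n" where
  "vertex_act H w = restrict (signed_act w) (vertices_in H)"

definition hyperplane_cycle_index :: "(real ^ 'n::finite) set \<Rightarrow> rat_mpoly" where
  "hyperplane_cycle_index H = cycle_index (hyperplane_group H) (vertices_in H) (vertex_act H)"

text \<open>The indeterminates \<open>u\<^sub>1\<close> and \<open>u\<^sub>2\<close> are those with indices 1 and 2.\<close>

definition hyperplane_C :: "(real ^ 'n::finite) set \<Rightarrow> rat_mpoly" where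
  "hyperplane_C H = mpoly_subst (\<lambda>i. mpoly_var 1 ^ i + mpoly_var 2 ^ i) (hyperplane_cycle_index H)"

definition coeff_u1_u2 :: "nat \<Rightarrow> nat \<Rightarrow> rat_mpoly \<Rightarrow> rat" where
  "coeff_u1_u2 p q F =
     Poly_Mapping.lookup F (Poly_Mapping.single 1 p + Poly_Mapping.single 2 q)"

lemma finite_cube_vertices: "finite (cube_vertices :: (real ^ 'n::finite) set)"
proof (rule finite_imageD)
  show "inj_on vec_nth (cube_vertices :: (real ^ 'n) set)"
    by (auto simp: inj_on_def vec_nth_inject)
  have "vec_nth ` (cube_vertices :: (real ^ 'n) set) \<subseteq> PiE UNIV (\<lambda>_. {0, 1})"
    by (auto simp: cube_vertices_def)
  then show "finite (vec_nth ` (cube_vertices :: (real ^ 'n) set))"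
    by (rule finite_subset) (simp add: finite_PiE)
qed

lemma finite_vertices_in: "finite (vertices_in (H :: (real ^ 'n::finite) set))"
  by (simp add: vertices_in_def finite_cube_vertices)

lemma signed_act_cube_vertices: "x \<in> cube_vertices \<Longrightarrow> signed_act w x \<in> cube_vertices"
  by (auto simp: cube_vertices_def signed_act_def)

lemma finite_hyperoctahedral_group:
  "finite (carrier (hyperoctahedral_group :: ('n::finite) signed_perm monoid))"
  by simp

lemma subgroup_hyperplane_group:
  "subgroup (carrier (hyperplane_group (H :: (real ^ 'n::finite) set))) hyperoctahedral_group"
proof -
  interpret group "hyperoctahedral_group :: 'n signed_perm monoid"
    by (rule group_hyperoctahedral_group)
  show ?thesis
  proof (rule subgroupI)
    have "\<one>\<^bsub>hyperoctahedral_group\<^esub> \<in> carrier (hyperplane_group H)"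
      by (simp add: hyperplane_group_def signed_act_one)
    then show "carrier (hyperplane_group H) \<noteq> {}"
      by blast
  next
    fix w assume "w \<in> carrier (hyperplane_group H)"
    then have w: "w \<in> carrier hyperoctahedral_group" "signed_act w ` H = H"
      by (auto simp: hyperplane_group_def)
    have "signed_act (inv\<^bsub>hyperoctahedral_group\<^esub> w) ` (signed_act w ` H) = H"
      by (simp add: image_image signed_act_inv w(1))
    with w show "inv\<^bsub>hyperoctahedral_group\<^esub> w \<in> carrier (hyperplane_group H)"
      by (simp add: hyperplane_group_def)
  next
    fix v w assume "v \<in> carrier (hyperplane_group H)" "w \<in> carrier (hyperplane_group H)"
    then have "v \<in> carrier hyperoctahedral_group" "signed_act v ` H = H"
        "w \<in> carrier hyperoctahedral_group" "signed_act w ` H = H"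
      by (auto simp: hyperplane_group_def)
    moreover from this have "signed_act (v \<otimes>\<^bsub>hyperoctahedral_group\<^esub> w) ` H = H"
      by (simp add: signed_act_mult flip: image_image)
    ultimately show "v \<otimes>\<^bsub>hyperoctahedral_group\<^esub> w \<in> carrier (hyperplane_group H)"
      by (simp add: hyperplane_group_def)
  qed (auto simp: hyperplane_group_def)
qed

lemma group_hyperplane_group: "group (hyperplane_group (H :: (real ^ 'n::finite) set))"
  using group.subgroup_imp_group[OF group_hyperoctahedral_group subgroup_hyperplane_group[of H]]
  by (simp add: hyperplane_group_def)

lemma signed_act_vertices_in:
  assumes "w \<in> carrier (hyperplane_group H)" "x \<in> vertices_in H"
  shows "signed_act w x \<in> vertices_in H"
  using assms by (auto simp: hyperplane_group_def vertices_in_def signed_act_cube_vertices)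

lemma group_action_vertex_act:
  fixes H :: "(real ^ 'n::finite) set"
  shows "group_action (hyperplane_group H) (vertices_in H) (vertex_act H)"
proof -
  have bij: "vertex_act H w \<in> Bij (vertices_in H)" if w: "w \<in> carrier (hyperplane_group H)" for w
  proof -
    have "inj_on (signed_act w) (vertices_in H)"
      using w by (intro inj_on_inverseI[where g = "signed_act (inv\<^bsub>hyperoctahedral_group\<^esub> w)"])
                 (auto simp: hyperplane_group_def signed_act_inv)
    then have "bij_betw (signed_act w) (vertices_in H) (vertices_in H)"
      using signed_act_vertices_in[OF w] finite_vertices_in[of H]
      by (metis bij_betw_def endo_inj_surj image_subsetI)
    then show ?thesis
      by (simp add: Bij_def vertex_act_def cong: bij_betw_cong)
  qed
  have "vertex_act H \<in> hom (hyperplane_group H) (BijGroup (vertices_in H))"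
  proof (rule homI)
    fix v w assume "v \<in> carrier (hyperplane_group H)" "w \<in> carrier (hyperplane_group H)"
    then have "vertex_act H (v \<otimes>\<^bsub>hyperoctahedral_group\<^esub> w) =
        compose (vertices_in H) (vertex_act H v) (vertex_act H w)"
      by (auto simp: vertex_act_def compose_def restrict_def signed_act_mult fun_eq_iff
            signed_act_vertices_in)
    then show "vertex_act H (v \<otimes>\<^bsub>hyperplane_group H\<^esub> w) =
        vertex_act H v \<otimes>\<^bsub>BijGroup (vertices_in H)\<^esub> vertex_act H w"
      using bij \<open>v \<in> _\<close> \<open>w \<in> _\<close> by (simp add: BijGroup_def hyperplane_group_def)
  qed (use bij in \<open>simp add: BijGroup_def\<close>)
  then show ?thesis
    unfolding group_action_def group_hom_def group_hom_axioms_def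
    by (simp add: group_hyperplane_group group_BijGroup)
qed

end

theory Submission
  imports Defs
begin

text \<open>
  If \<open>S\<close> is a set of cube vertices, then splitting along a coordinate on which \<open>S\<close> is not constant
  lowers the affine dimension of both halves, so \<open>S\<close> has at most \<open>2\<^sup>d\<close> elements, where \<open>d\<close> is its
  affine dimension. Hence more than \<open>2\<^sup>n\<^sup>-\<^sup>2\<close> vertices contained in the hyperplane \<open>H\<close> span \<open>H\<close>, and
  a signed permutation mapping one such set in \<open>H\<close> to another fixes \<open>H\<close>. The equivalence classes are
  therefore the orbits of the stabilizer of \<open>H\<close> on the \<open>k\<close>-subsets of the vertices in \<open>H\<close>, and these
  are counted by Burnside's lemma: a subset is fixed by a permutation iff it is a union of cycles, so
  the fixed \<open>k\<close>-subsets are enumerated by the product of \<open>u\<^sub>1\<^sup>i + u\<^sub>2\<^sup>i\<close> over the cycles, \<open>i\<close> being the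
  length of the cycle.
\<close>

section \<open>Substitution and coefficients\<close>

lemma mpoly_const_0 [simp]: "mpoly_const 0 = 0"
  by (simp add: mpoly_const_def)

lemma mpoly_const_add: "mpoly_const (a + b) = mpoly_const a + mpoly_const b"
  by (simp add: mpoly_const_def single_add)

lemma mpoly_const_mult: "mpoly_const (a * b) = mpoly_const a * mpoly_const b"
  by (simp add: mpoly_const_def mult_single)

lemma lookup_mpoly_const_mult: "Poly_Mapping.lookup (mpoly_const c * p) m = c * Poly_Mapping.lookup p m"
proof -
  have "mpoly_const c * p = Poly_Mapping.map ((*) c) p"
    by (simp add: mpoly_const_def mult_map_scale_conv_mult)
  then show ?thesis
    by (simp add: Poly_Mapping.map.rep_eq when_def)
qed

text \<open>Monomials outside the support contribute 0. Additivity needs a common index set, since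
  cancellation can shrink the support of a sum.\<close>

lemma mpoly_subst_superset:
  assumes "finite K" "Poly_Mapping.keys p \<subseteq> K"
  shows "mpoly_subst \<sigma> p = (\<Sum>m \<in> K. mpoly_const (Poly_Mapping.lookup p m) *
           (\<Prod>i \<in> Poly_Mapping.keys m. \<sigma> i ^ Poly_Mapping.lookup m i))"
  unfolding mpoly_subst_def using assms
  by (intro sum.mono_neutral_left) (auto simp: not_in_keys_iff_lookup_eq_zero)

lemma mpoly_subst_add: "mpoly_subst \<sigma> (p + q) = mpoly_subst \<sigma> p + mpoly_subst \<sigma> q"
proof -
  let ?K = "Poly_Mapping.keys p \<union> Poly_Mapping.keys q"
  have "Poly_Mapping.keys (p + q) \<subseteq> ?K"
    by (rule Poly_Mapping.keys_add)
  then show ?thesis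
    by (simp add: mpoly_subst_superset[of ?K] lookup_add mpoly_const_add distrib_right sum.distrib)
qed

lemma mpoly_subst_0 [simp]: "mpoly_subst \<sigma> 0 = 0"
  by (simp add: mpoly_subst_def)

lemma mpoly_subst_sum: "mpoly_subst \<sigma> (\<Sum>x \<in> A. p x) = (\<Sum>x \<in> A. mpoly_subst \<sigma> (p x))"
  by (induction A rule: infinite_finite_induct) (simp_all add: mpoly_subst_add)

lemma mpoly_subst_const_mult: "mpoly_subst \<sigma> (mpoly_const c * p) = mpoly_const c * mpoly_subst \<sigma> p"
proof -
  have "Poly_Mapping.keys (mpoly_const c * p) \<subseteq> Poly_Mapping.keys p"
    by (auto simp: in_keys_iff lookup_mpoly_const_mult)
  then have "mpoly_subst \<sigma> (mpoly_const c * p) = (\<Sum>m \<in> Poly_Mapping.keys p.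
      mpoly_const (Poly_Mapping.lookup (mpoly_const c * p) m) *
      (\<Prod>i \<in> Poly_Mapping.keys m. \<sigma> i ^ Poly_Mapping.lookup m i))"
    by (intro mpoly_subst_superset) simp_all
  then show ?thesis
    by (simp add: mpoly_subst_def lookup_mpoly_const_mult mpoly_const_mult sum_distrib_left mult.assoc)
qed

lemma mpoly_var_power: "mpoly_var i ^ e = Poly_Mapping.single (Poly_Mapping.single i e) 1"
  by (induction e) (simp_all add: mpoly_var_def mult_single single_one flip: single_add)

lemma mpoly_subst_monomial:
  assumes "finite I"
  shows "mpoly_subst \<sigma> (\<Prod>i \<in> I. mpoly_var i ^ e i) = (\<Prod>i \<in> I. \<sigma> i ^ e i)"
proof -
  \<comment> \<open>\<open>m\<close> collects the exponents. Indices with exponent 0 are absent from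
    its keys; extending the product from the keys to \<open>I\<close> adds only factors equal to
    1.\<close>
  define m where "m = (\<Sum>i \<in> I. Poly_Mapping.single i (e i))"
  have "(\<Prod>i \<in> J. mpoly_var i ^ e i) = Poly_Mapping.single (\<Sum>i \<in> J. Poly_Mapping.single i (e i)) 1"
    if "finite J" for J
    using that by induction (simp_all add: mpoly_var_power mult_single single_one)
  then have "(\<Prod>i \<in> I. mpoly_var i ^ e i) = Poly_Mapping.single m 1"
    using assms m_def by simp
  then have "mpoly_subst \<sigma> (\<Prod>i \<in> I. mpoly_var i ^ e i) =
      (\<Prod>i \<in> Poly_Mapping.keys m. \<sigma> i ^ Poly_Mapping.lookup m i)"
    by (simp add: mpoly_subst_def mpoly_const_def single_one)
  moreover have m: "Poly_Mapping.lookup m i = (if i \<in> I then e i else 0)" for i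
    using assms by (simp add: m_def lookup_sum lookup_single when_def sum.delta)
  then have "Poly_Mapping.keys m \<subseteq> I"
    by (auto simp: in_keys_iff split: if_splits)
  then have "(\<Prod>i \<in> Poly_Mapping.keys m. \<sigma> i ^ Poly_Mapping.lookup m i) =
      (\<Prod>i \<in> I. \<sigma> i ^ Poly_Mapping.lookup m i)"
    using assms by (intro prod.mono_neutral_left) (auto simp: not_in_keys_iff_lookup_eq_zero)
  ultimately show ?thesis
    by (simp add: m)
qed

section \<open>Coefficient extraction\<close>

lemma coeff_u1_u2_sum: "coeff_u1_u2 p q (\<Sum>x \<in> A. F x) = (\<Sum>x \<in> A. coeff_u1_u2 p q (F x))"
  by (simp add: coeff_u1_u2_def lookup_sum)

lemma coeff_u1_u2_const_mult: "coeff_u1_u2 p q (mpoly_const c * F) = c * coeff_u1_u2 p q F"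
  by (simp add: coeff_u1_u2_def lookup_mpoly_const_mult)

lemma coeff_u1_u2_monomial:
  "coeff_u1_u2 p q (mpoly_var 1 ^ a * mpoly_var 2 ^ b) = (if a = p \<and> b = q then 1 else 0)"
proof -
  let ?m = "\<lambda>a b. Poly_Mapping.single (1::nat) (a::nat) + Poly_Mapping.single 2 b"
  have "Poly_Mapping.lookup (?m a b) 1 = a" "Poly_Mapping.lookup (?m a b) 2 = b" for a b
    by (simp_all add: lookup_add lookup_single when_def)
  then have "?m a b = ?m p q \<longleftrightarrow> a = p \<and> b = q"
    by metis
  then show ?thesis
    by (simp add: coeff_u1_u2_def mpoly_var_power mult_single lookup_single when_def)
qed

section \<open>Subsets fixed by a permutation\<close>

context
  fixes f :: "'x \<Rightarrow> 'x" and X :: "'x set"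
  assumes fin: "finite X" and bij: "bij_betw f X X"
begin

section \<open>Cycles as a partition of the underlying set\<close>

lemma orbit_subset_of_bij_betw:
  assumes "x \<in> X"
  shows "Orbits.orbit f x \<subseteq> X"
proof
  fix y assume "y \<in> Orbits.orbit f x"
  then show "y \<in> X"
    by induction (use assms bij in \<open>auto dest: bij_betwE\<close>)
qed

text \<open>The inductive orbit starts at \<open>f x\<close>; that it returns to \<open>x\<close>
  uses that \<open>f\<close> permutes a finite set.\<close>

lemma self_in_orbit_of_bij_betw:
  assumes "x \<in> X"
  shows "x \<in> Orbits.orbit f x"
proof -
  \<comment> \<open>The behaviour of \<open>f\<close> outside \<open>X\<close> is unknown, so
    \<open>f\<close> is replaced by a genuine permutation with the same orbits in
    \<open>X\<close>.\<close>
  let ?g = "\<lambda>x. if x \<in> X then f x else x"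
  have "bij_betw ?g X X"
    using bij by (simp cong: bij_betw_cong)
  then have "?g permutes X"
    by (rule bij_imp_permutes) simp
  then have "x \<in> Orbits.orbit ?g x"
    using fin by (intro permutation_self_in_orbit) (auto simp: permutation_permutes)
  also have "Orbits.orbit ?g x = Orbits.orbit f x"
    by (rule orbit_cong0[OF assms]) (use bij in \<open>auto dest: bij_betwE\<close>)
  finally show ?thesis .
qed

lemma orbit_eq_of_bij_betw:
  assumes "x \<in> X" "y \<in> Orbits.orbit f x"
  shows "Orbits.orbit f y = Orbits.orbit f x"
proof -
  have "x \<in> Orbits.orbit f y"
    using self_in_orbit_of_bij_betw[OF assms(1)] assms(2) by (rule orbit_swap)
  show ?thesis
    using orbit_trans[OF _ assms(2)] orbit_trans[OF _ \<open>x \<in> Orbits.orbit f y\<close>] by blast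
qed

lemma disjoint_orbits_of_bij_betw: "disjoint (Orbits.orbit f ` X)"
  by (rule disjointI) (metis disjoint_iff imageE orbit_eq_of_bij_betw)

lemma card_Union_orbits:
  assumes "A \<subseteq> Orbits.orbit f ` X"
  shows "card (\<Union>A) = (\<Sum>c \<in> A. card c)"
proof (rule card_Union_disjoint)
  show "disjoint A"
    using disjoint_orbits_of_bij_betw assms by (rule pairwise_subset)
  show "finite c" if "c \<in> A" for c
    using that assms orbit_subset_of_bij_betw fin by (blast intro: finite_subset)
qed

lemma Union_orbits: "\<Union>(Orbits.orbit f ` X) = X"
  using orbit_subset_of_bij_betw self_in_orbit_of_bij_betw by blast

text \<open>A cycle meeting an invariant set lies inside it, so the set is the union of the cycles
  of its points. Conversely, cycles are disjoint and nonempty, so a family of cycles is determined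
  by its union.\<close>

lemma bij_betw_Union_orbits:
  "bij_betw Union (Pow (Orbits.orbit f ` X)) {S. S \<subseteq> X \<and> f ` S = S}"
proof (rule bij_betw_byWitness[where f' = "\<lambda>S. Orbits.orbit f ` S"])
  have rep: "Orbits.orbit f ` \<Union>A = A" if "A \<subseteq> Orbits.orbit f ` X" for A
  proof
    show "Orbits.orbit f ` \<Union>A \<subseteq> A"
      using that orbit_eq_of_bij_betw by fastforce
    show "A \<subseteq> Orbits.orbit f ` \<Union>A"
    proof
      fix c assume "c \<in> A"
      with that obtain x where "x \<in> X" "c = Orbits.orbit f x"
        by blast
      with \<open>c \<in> A\<close> show "c \<in> Orbits.orbit f ` \<Union>A"
        using self_in_orbit_of_bij_betw by blast
    qed
  qed
  then show "\<forall>A \<in> Pow (Orbits.orbit f ` X). Orbits.orbit f ` \<Union>A = A"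
    by blast
  have inv: "Orbits.orbit f x \<subseteq> S" if "S \<subseteq> X" "f ` S = S" "x \<in> S" for S x
  proof
    fix y assume "y \<in> Orbits.orbit f x"
    then show "y \<in> S"
      by induction (use that in auto)
  qed
  then show "\<forall>S \<in> {S. S \<subseteq> X \<and> f ` S = S}. \<Union>(Orbits.orbit f ` S) = S"
    using self_in_orbit_of_bij_betw by blast
  show "Union ` Pow (Orbits.orbit f ` X) \<subseteq> {S. S \<subseteq> X \<and> f ` S = S}"
  proof safe
    fix A y c assume A: "A \<subseteq> Orbits.orbit f ` X" and "c \<in> A" "y \<in> c"
    then show "y \<in> X"
      using orbit_subset_of_bij_betw by blast
  next
    fix A assume A: "A \<subseteq> Orbits.orbit f ` X"
    have "\<Union>A \<subseteq> X"
      using A orbit_subset_of_bij_betw by blast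
    \<comment> \<open>Closure under \<open>f\<close> gives only an inclusion; injectivity on a
      finite set turns it into an equality.\<close>
    moreover have "f ` \<Union>A \<subseteq> \<Union>A"
      using A by (blast intro: orbit.step)
    moreover have "inj_on f (\<Union>A)"
      using \<open>\<Union>A \<subseteq> X\<close> bij inj_on_subset by (auto simp: bij_betw_def)
    ultimately have "f ` \<Union>A = \<Union>A"
      using fin by (meson endo_inj_surj finite_subset)
    then show "\<And>x c. x \<in> c \<Longrightarrow> c \<in> A \<Longrightarrow> f x \<in> \<Union>A"
      and "\<And>x c. x \<in> c \<Longrightarrow> c \<in> A \<Longrightarrow> x \<in> f ` \<Union>A"
      by blast+
  qed
  show "(\<lambda>S. Orbits.orbit f ` S) ` {S. S \<subseteq> X \<and> f ` S = S} \<subseteq> Pow (Orbits.orbit f ` X)"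
    by blast
qed

section \<open>The generating function of invariant subsets\<close>

lemma mpoly_subst_cycle_monomial:
  "mpoly_subst \<sigma> (cycle_monomial f X) = (\<Prod>c \<in> Orbits.orbit f ` X. \<sigma> (card c))"
proof -
  let ?O = "Orbits.orbit f ` X"
  \<comment> \<open>Cycles are nonempty subsets of \<open>X\<close>, so the index range of the cycle
    monomial misses none of them when they are grouped by length.\<close>
  have "card c \<in> {1..card X}" if "c \<in> ?O" for c
  proof -
    have "c \<subseteq> X" "c \<noteq> {}"
      using that orbit_subset_of_bij_betw self_in_orbit_of_bij_betw by blast+
    then show ?thesis
      using fin by (auto simp: Suc_le_eq card_gt_0_iff card_mono finite_subset)
  qed
  then have "(\<Prod>i = 1..card X. \<Prod>c \<in> {c \<in> ?O. card c = i}. \<sigma> (card c)) = (\<Prod>c \<in> ?O. \<sigma> (card c))"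
    using fin by (intro prod.group) auto
  moreover have "(\<Prod>c \<in> {c \<in> ?O. card c = i}. \<sigma> (card c)) = \<sigma> i ^ num_cycles f X i" for i
    by (simp add: num_cycles_def)
  ultimately show ?thesis
    by (simp add: cycle_monomial_def mpoly_subst_monomial)
qed

text \<open>Expanding the product over the cycles means choosing a power of \<open>u_1\<close> or of
  \<open>u_2\<close> for each cycle. The cycles with \<open>u_1\<close> form a family
  \<open>A\<close>, and the exponent of \<open>u_1\<close> is the size of its union, an invariant
  set.\<close>

lemma coeff_cycle_monomial:
  "coeff_u1_u2 k (card X - k)
     (mpoly_subst (\<lambda>i. mpoly_var 1 ^ i + mpoly_var 2 ^ i) (cycle_monomial f X)) =
   of_nat (card {S. S \<subseteq> X \<and> card S = k \<and> f ` S = S})"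
proof -
  let ?O = "Orbits.orbit f ` X"
  \<comment> \<open>The exponent of \<open>u_2\<close> is determined by that of \<open>u_1\<close>,
    so extracting the coefficient only tests \<open>card (\<Union>A) = k\<close>.\<close>
  have card_compl: "card (\<Union>(?O - A)) = card X - card (\<Union>A)" if "A \<subseteq> ?O" for A
  proof -
    have "card (\<Union>A) + card (\<Union>(?O - A)) = card (\<Union>?O)"
      using that fin by (simp add: card_Union_orbits sum.subset_diff[of A ?O])
    then show ?thesis
      by (simp add: Union_orbits)
  qed
  have "mpoly_subst (\<lambda>i. mpoly_var 1 ^ i + mpoly_var 2 ^ i) (cycle_monomial f X) =
      (\<Sum>A \<in> Pow ?O. mpoly_var 1 ^ card (\<Union>A) * mpoly_var 2 ^ card (\<Union>(?O - A)))"
    using fin by (simp add: mpoly_subst_cycle_monomial prod_add card_Union_orbits power_sum)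
  then have "coeff_u1_u2 k (card X - k)
      (mpoly_subst (\<lambda>i. mpoly_var 1 ^ i + mpoly_var 2 ^ i) (cycle_monomial f X)) =
      (\<Sum>A \<in> Pow ?O. if card (\<Union>A) = k then 1 else 0)"
    by (auto simp: coeff_u1_u2_sum coeff_u1_u2_monomial card_compl intro!: sum.cong
        simp del: One_nat_def)
  also have "\<dots> = (\<Sum>S \<in> {S. S \<subseteq> X \<and> f ` S = S}. if card S = k then 1 else 0)"
    by (rule sum.reindex_bij_betw[OF bij_betw_Union_orbits])
  also have "\<dots> = of_nat (card {S. S \<subseteq> X \<and> card S = k \<and> f ` S = S})"
  proof -
    have "finite {S. S \<subseteq> X \<and> f ` S = S}"
      using fin by simp
    moreover have "{S. S \<subseteq> X \<and> f ` S = S} \<inter> {S. card S = k} = {S. S \<subseteq> X \<and> card S = k \<and> f ` S = S}"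
      by blast
    ultimately show ?thesis
      by (simp add: sum.If_cases)
  qed
  finally show ?thesis .
qed

end

section \<open>Orbits on subsets of fixed size\<close>

context group_action
begin

text \<open>This makes Burnside's lemma applicable to the \<open>k\<close>-subsets. The image maps
  are restricted because the elements of \<open>Bij\<close> are extensional.\<close>

lemma group_action_subsets:
  defines "subsets k \<equiv> {S. S \<subseteq> E \<and> card S = k}"
  shows "group_action G (subsets k) (\<lambda>g. restrict (image (\<phi> g)) (subsets k))"
proof -
  interpret group G
    using group_hom by (rule group_hom.axioms)
  let ?\<psi> = "\<lambda>g. restrict (image (\<phi> g)) (subsets k)"
  have closed: "\<phi> g ` S \<in> subsets k" if "g \<in> carrier G" "S \<in> subsets k" for g S
    using that surj_prop[of g] inj_prop[of g]
    by (auto simp: subsets_def card_image inj_on_subset)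
  have comp: "\<phi> (g \<otimes> h) ` S = \<phi> g ` \<phi> h ` S"
    if "g \<in> carrier G" "h \<in> carrier G" "S \<in> subsets k" for g h S
    unfolding image_image using that
    by (intro image_cong) (auto simp: subsets_def composition_rule)
  have one: "\<phi> \<one> ` S = S" if "S \<in> subsets k" for S
    using that by (force simp: subsets_def simp flip: id_eq_one)
  have bij: "?\<psi> g \<in> Bij (subsets k)" if g: "g \<in> carrier G" for g
  proof -
    have "bij_betw (image (\<phi> g)) (subsets k) (subsets k)"
    proof (rule bij_betw_byWitness[where f' = "image (\<phi> (inv g))"])
      show "\<forall>S \<in> subsets k. \<phi> (inv g) ` \<phi> g ` S = S" "\<forall>S \<in> subsets k. \<phi> g ` \<phi> (inv g) ` S = S"
        using g by (simp_all add: one flip: comp)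
    qed (use g closed in auto)
    then show ?thesis
      by (simp add: Bij_def cong: bij_betw_cong)
  qed
  have "?\<psi> \<in> hom G (BijGroup (subsets k))"
  proof (rule homI)
    fix g h assume gh: "g \<in> carrier G" "h \<in> carrier G"
    then have "?\<psi> (g \<otimes> h) = compose (subsets k) (?\<psi> g) (?\<psi> h)"
      by (auto simp: compose_def restrict_def fun_eq_iff comp closed)
    then show "?\<psi> (g \<otimes> h) = ?\<psi> g \<otimes>\<^bsub>BijGroup (subsets k)\<^esub> ?\<psi> h"
      using bij gh by (simp add: BijGroup_def)
  qed (use bij in \<open>simp add: BijGroup_def\<close>)
  then show ?thesis
    unfolding group_action_def group_hom_def group_hom_axioms_def
    by (simp add: group_BijGroup)
qed

text \<open>By Burnside's lemma the number of orbits is the average number of fixed sets. Each such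
  number is a coefficient obtained from a cycle monomial, and linearity moves the average inside the
  substitution and the extraction.\<close>

theorem card_orbits_subsets:
  assumes "finite (carrier G)" "finite E"
  shows "of_nat (card {{\<phi> g ` S | g. g \<in> carrier G} | S. S \<subseteq> E \<and> card S = k}) =
    coeff_u1_u2 k (card E - k)
      (mpoly_subst (\<lambda>i. mpoly_var 1 ^ i + mpoly_var 2 ^ i) (cycle_index G E \<phi>))"
proof -
  interpret group G
    using group_hom by (rule group_hom.axioms)
  define X where "X = {S. S \<subseteq> E \<and> card S = k}"
  define \<psi> where "\<psi> g = restrict (image (\<phi> g)) X" for g
  interpret subsets: group_action G X \<psi>
    using group_action_subsets[of k] unfolding X_def \<psi>_def .
  have "finite X"
    using assms by (simp add: X_def)
  have "orbits G X \<psi> = {{\<phi> g ` S | g. g \<in> carrier G} | S. S \<in> X}"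
    unfolding orbits_def Group_Action.orbit_def by (rule Collect_cong) (auto simp: \<psi>_def)
  then have orbits: "orbits G X \<psi> = {{\<phi> g ` S | g. g \<in> carrier G} | S. S \<subseteq> E \<and> card S = k}"
    by (simp add: X_def)
  have fixed: "of_nat (card (invariants X \<psi> g)) =
      coeff_u1_u2 k (card E - k)
        (mpoly_subst (\<lambda>i. mpoly_var 1 ^ i + mpoly_var 2 ^ i) (cycle_monomial (\<phi> g) E))"
    if "g \<in> carrier G" for g
  proof -
    have "bij_betw (\<phi> g) E E"
      using that by (simp add: bij_betw_def inj_prop surj_prop)
    moreover have "invariants X \<psi> g = {S. S \<subseteq> E \<and> card S = k \<and> \<phi> g ` S = S}"
      by (auto simp: invariants_def X_def \<psi>_def)
    ultimately show ?thesis
      using assms by (simp add: coeff_cycle_monomial del: One_nat_def)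
  qed
  \<comment> \<open>This allows dividing Burnside's identity by the group order.\<close>
  have "card (carrier G) \<noteq> 0"
    using assms(1) one_closed by auto
  moreover have "of_nat (card (orbits G X \<psi>)) * of_nat (card (carrier G)) =
      (\<Sum>g \<in> carrier G. of_nat (card (invariants X \<psi> g)) :: rat)"
    using subsets.burnside[OF assms(1) \<open>finite X\<close>] unfolding order_def
    by (simp flip: of_nat_mult of_nat_sum)
  ultimately show ?thesis
    by (simp add: cycle_index_def mpoly_subst_const_mult mpoly_subst_sum coeff_u1_u2_const_mult
        coeff_u1_u2_sum fixed field_simps
        del: One_nat_def flip: orbits)
qed

end

section \<open>Vertex sets spanning a hyperplane\<close>

text \<open>Bounding the dimension only from above lets the induction hypothesis apply however far
  the dimension of a half drops.\<close>

lemma card_cube_vertices_le: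
  fixes S :: "(real ^ 'n::finite) set"
  assumes "S \<subseteq> cube_vertices" "aff_dim S \<le> int d"
  shows "card S \<le> 2 ^ d"
  using assms
proof (induction d arbitrary: S)
  case 0
  \<comment> \<open>The empty set has affine dimension -1 and falls under this case too.\<close>
  have "S = {} \<or> (\<exists>a. S = {a})"
    using 0(2) aff_dim_geq[of S] by (metis aff_dim_empty aff_dim_sing aff_dim_eq_0 of_nat_0 order_antisym
        aff_dim_negative_iff linorder_not_le)
  then show ?case
    by auto
next
  case (Suc d)
  show ?case
  proof (cases "\<exists>x \<in> S. \<exists>y \<in> S. x \<noteq> y")
    case False
    then have "card S \<le> 1"
      by (metis card.empty card_1_singleton_iff empty_iff is_singletonI' is_singleton_altdef
          le_zero_eq linear order_refl)
    then show ?thesis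
      by (rule order_trans) simp
  next
    case True
    then obtain x y i where xy: "x \<in> S" "y \<in> S" "x $ i \<noteq> y $ i"
      by (auto simp: vec_eq_iff)
    have face: "card {v \<in> S. v $ i = c} \<le> 2 ^ d" for c
    proof -
      let ?F = "{v \<in> S. v $ i = c}"
      have "affine {v :: real ^ 'n. axis i 1 \<bullet> v = c}"
        by (rule affine_hyperplane)
      then have "affine hull ?F \<subseteq> {v. v $ i = c}"
        by (intro hull_minimal) (auto simp: inner_axis' )
      \<comment> \<open>The points \<open>x\<close> and \<open>y\<close> differ in coordinate
        \<open>i\<close>, so they cannot both satisfy \<open>v $ i = c\<close>. The hull of the half
        is thus strictly smaller than that of \<open>S\<close>.\<close>
      then have "\<not> {x, y} \<subseteq> affine hull ?F"
        using xy by auto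
      moreover have "affine hull ?F \<subseteq> affine hull S"
        by (rule hull_mono) auto
      ultimately have "affine hull ?F \<subset> affine hull S"
        using xy hull_inc[of _ S affine] by blast
      then have "aff_dim ?F < aff_dim S"
        by (rule aff_dim_psubset)
      then show ?thesis
        using Suc by (intro Suc.IH) auto
    qed
    have "S = {v \<in> S. v $ i = 0} \<union> {v \<in> S. v $ i = 1}"
      using Suc.prems(1) by (auto simp: cube_vertices_def)
    then have "card S \<le> card {v \<in> S. v $ i = 0} + card {v \<in> S. v $ i = 1}"
      using card_Un_le[of "{v \<in> S. v $ i = 0}" "{v \<in> S. v $ i = 1}"] by simp
    then show ?thesis
      using face[of 0] face[of 1] by simp
  qed
qed

text \<open>A cube vertex outside \<open>S\<close> is separated from \<open>S\<close> by a
  half-space. Hence a 0/1-polytope determines its vertex set.\<close>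

lemma convex_hull_inter_cube_vertices:
  fixes S :: "(real ^ 'n::finite) set"
  assumes "S \<subseteq> cube_vertices"
  shows "convex hull S \<inter> cube_vertices = S"
proof
  show "S \<subseteq> convex hull S \<inter> cube_vertices"
    using assms by (auto intro: hull_inc)
  show "convex hull S \<inter> cube_vertices \<subseteq> S"
  proof (rule ccontr)
    assume "\<not> convex hull S \<inter> cube_vertices \<subseteq> S"
    then obtain v where v: "v \<in> convex hull S" "v \<in> cube_vertices" "v \<notin> S"
      by blast
    \<comment> \<open>On cube vertices this is the Hamming distance to \<open>v\<close>, which is at
      least 1 on \<open>S\<close>. For fixed \<open>v\<close> it is affine in \<open>x\<close>, so
      that the bound passes to the convex hull.\<close>
    define dist_v :: "real ^ 'n \<Rightarrow> real"
      where "dist_v x = (\<Sum>i \<in> UNIV. if v $ i = 1 then 1 - x $ i else x $ i)" for x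
    have dist_v: "dist_v x = (\<Sum>i \<in> UNIV. if v $ i = 1 then 1 else 0) +
        (\<chi> i. if v $ i = 1 then -1 else 1) \<bullet> x" for x
      unfolding dist_v_def inner_vec_def sum.distrib[symmetric] by (rule sum.cong) auto
    have "S \<subseteq> {x. dist_v x \<ge> 1}"
    proof safe
      fix x assume "x \<in> S"
      then have x: "x $ i = 0 \<or> x $ i = 1" for i
        using assms by (auto simp: cube_vertices_def)
      from \<open>x \<in> S\<close> v obtain j where "x $ j \<noteq> v $ j"
        by (metis vec_eq_iff)
      moreover have "v $ j = 0 \<or> v $ j = 1"
        using v by (auto simp: cube_vertices_def)
      ultimately have "1 = (if v $ j = 1 then 1 - x $ j else x $ j)"
        using x[of j] by auto
      also have "\<dots> \<le> dist_v x"
        unfolding dist_v_def by (rule member_le_sum)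
          (use x in \<open>auto, (metis diff_ge_0_iff_ge le_numeral_extra(3,4) zero_le_one)+\<close>)
      finally show "dist_v x \<ge> 1" .
    qed
    moreover have "convex {x. dist_v x \<ge> 1}"
    proof -
      have "{x. dist_v x \<ge> 1} = {x. (\<chi> i. if v $ i = 1 then -1 else 1) \<bullet> x \<ge>
          1 - (\<Sum>i \<in> UNIV. if v $ i = 1 then 1 else 0)}"
        by (auto simp: dist_v)
      then show ?thesis
        by (simp add: convex_halfspace_ge)
    qed
    ultimately have "convex hull S \<subseteq> {x. dist_v x \<ge> 1}"
      by (rule hull_minimal)
    with v have "dist_v v \<ge> 1"
      by blast
    moreover have "dist_v v = 0"
      unfolding dist_v_def by (rule sum.neutral) (use v in \<open>auto simp: cube_vertices_def\<close>)
    ultimately show False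
      by simp
  qed
qed

section \<open>Signed permutations as affine maps\<close>

lemma signed_act_affine:
  fixes w :: "('n::finite) signed_perm"
  obtains c A where "linear A" "signed_act w = (\<lambda>x. c + A x)"
proof
  \<comment> \<open>A coordinate \<open>1 - t\<close> splits into the translation by 1 and the
    linear part \<open>- t\<close>.\<close>
  show "linear (\<lambda>x :: real ^ 'n. \<chi> i. if snd w i then x $ fst w i else - x $ fst w i)"
    by (rule linearI) (auto simp: vec_eq_iff)
  show "signed_act w = (\<lambda>x. (\<chi> i. if snd w i then 0 else 1) +
      (\<chi> i. if snd w i then x $ fst w i else - x $ fst w i))"
    by (auto simp: signed_act_def vec_eq_iff fun_eq_iff)
qed

lemma signed_act_convex_hull:
  "signed_act w ` (convex hull S) = convex hull (signed_act w ` (S :: (real ^ 'n::finite) set))"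
proof -
  obtain c A where A: "linear A" "signed_act w = (\<lambda>x :: real ^ 'n. c + A x)"
    by (rule signed_act_affine)
  have "convex hull ((+) c ` A ` S) = (+) c ` A ` (convex hull S)"
    by (simp only: convex_hull_translation convex_hull_linear_image[OF A(1)])
  then show ?thesis
    by (simp add: A(2) image_image)
qed

lemma signed_act_affine_hull:
  "signed_act w ` (affine hull S) = affine hull (signed_act w ` (S :: (real ^ 'n::finite) set))"
proof -
  obtain c A where A: "linear A" "signed_act w = (\<lambda>x :: real ^ 'n. c + A x)"
    by (rule signed_act_affine)
  have "bounded_linear A"
    using A(1) by (simp add: linear_conv_bounded_linear)
  then have "affine hull ((+) c ` A ` S) = (+) c ` A ` (affine hull S)"
    by (simp only: affine_hull_translation affine_hull_linear_image)
  then show ?thesis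
    by (simp add: A(2) image_image)
qed

text \<open>By the bound on cube vertices, \<open>S\<close> has affine dimension at least
  \<open>n - 1\<close>, which is that of \<open>H\<close>. The assumption \<open>n \<ge> 2\<close>
  makes the natural subtraction \<open>n - 2\<close> exact.\<close>

lemma affine_hull_eq_hyperplane:
  fixes H :: "(real ^ 'n::finite) set"
  assumes "CARD('n) \<ge> 2" "spanned_hyperplane H" "S \<subseteq> vertices_in H" "card S > 2 ^ (CARD('n) - 2)"
  shows "affine hull S = H"
proof -
  obtain a b where H: "a \<noteq> 0" "H = {x. a \<bullet> x = b}"
    using assms(2) by (auto simp: spanned_hyperplane_def)
  have S: "S \<subseteq> cube_vertices" "S \<subseteq> H"
    using assms(3) by (auto simp: vertices_in_def)
  have "\<not> aff_dim S \<le> int (CARD('n) - 2)"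
    using card_cube_vertices_le[OF S(1)] assms(4) by (metis linorder_not_le)
  moreover have "aff_dim H = int CARD('n) - 1"
    using H by (simp add: aff_dim_hyperplane)
  moreover have "aff_dim S \<le> aff_dim H"
    using S(2) by (rule aff_dim_subset)
  ultimately have "aff_dim S = aff_dim H"
    using assms(1) by linarith
  then have "affine hull S = affine hull H"
    using S(2) aff_dim_eq_full_gen by blast
  then show ?thesis
    using H(2) by (simp add: affine_hyperplane hull_same)
qed

section \<open>Equivalence classes of polytopes as orbits of vertex sets\<close>

lemma convex_hull_in_polytopes_in_iff:
  fixes H :: "(real ^ 'n::finite) set"
  assumes "spanned_hyperplane H" "S \<subseteq> cube_vertices" "S \<noteq> {}"
  shows "convex hull S \<in> polytopes_in H \<longleftrightarrow> S \<subseteq> vertices_in H"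
proof -
  have "convex H"
    using assms(1) convex_hyperplane by (auto simp: spanned_hyperplane_def)
  then have "convex hull S \<subseteq> H \<longleftrightarrow> S \<subseteq> H"
    by (meson hull_minimal hull_subset order_trans)
  then show ?thesis
    using assms by (auto simp: polytopes_in_def zero_one_polytope_def vertices_in_def)
qed

text \<open>The equivalence allows any signed permutation, but one that keeps the polytope inside
  \<open>H\<close> must stabilize \<open>H\<close>, so the class is an orbit of the
  stabilizer.\<close>

theorem partial_class_convex_hull:
  fixes H :: "(real ^ 'n::finite) set"
  assumes "CARD('n) \<ge> 2" "spanned_hyperplane H" "S \<subseteq> vertices_in H" "card S > 2 ^ (CARD('n) - 2)"
  shows "zero_one_equiv H `` {convex hull S} =
    (hull) convex ` {vertex_act H w ` S | w. w \<in> carrier (hyperplane_group H)}"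
proof -
  have cube: "S \<subseteq> cube_vertices" and "S \<noteq> {}"
    using assms(3,4) by (auto simp: vertices_in_def)
  have act: "vertex_act H w ` S = signed_act w ` S" for w
    using assms(3) by (auto simp: vertex_act_def intro!: image_cong)
  have P: "convex hull S \<in> polytopes_in H"
    using assms(2,3) cube \<open>S \<noteq> {}\<close> by (simp add: convex_hull_in_polytopes_in_iff)
  have key: "signed_act w ` (convex hull S) \<in> polytopes_in H \<longleftrightarrow> w \<in> carrier (hyperplane_group H)"
    if w: "w \<in> carrier hyperoctahedral_group" for w
  proof -
    have wS: "signed_act w ` S \<subseteq> cube_vertices" "signed_act w ` S \<noteq> {}"
      using cube \<open>S \<noteq> {}\<close> by (auto simp: signed_act_cube_vertices)
    have "inj_on (signed_act w) S"
      using w by (metis inj_on_inverseI signed_act_inv(1))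
    then have card: "card (signed_act w ` S) = card S"
      by (rule card_image)
    have "signed_act w ` S \<subseteq> vertices_in H \<longleftrightarrow> signed_act w ` H = H"
    proof
      assume "signed_act w ` S \<subseteq> vertices_in H"
      \<comment> \<open>The image has as many points as \<open>S\<close>, so both sets span
        \<open>H\<close>; an affine map carries the hull of one to the hull of the other.\<close>
      with assms card have "affine hull (signed_act w ` S) = H" "affine hull S = H"
        by (simp_all add: affine_hull_eq_hyperplane)
      then show "signed_act w ` H = H"
        by (metis signed_act_affine_hull)
    next
      assume "signed_act w ` H = H"
      then show "signed_act w ` S \<subseteq> vertices_in H"
        using wS assms(3) by (auto simp: vertices_in_def)
    qed
    then show ?thesis
      using assms(2) w wS
      by (simp add: signed_act_convex_hull convex_hull_in_polytopes_in_iff hyperplane_group_def)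
  qed
  have "zero_one_equiv H `` {convex hull S} =
      {signed_act w ` (convex hull S) | w. w \<in> carrier (hyperplane_group H)}"
    (is "?L = ?R")
  proof
    show "?L \<subseteq> ?R"
      using key by (auto simp: zero_one_equiv_def simp del: split_paired_Ex)
    have "w \<in> carrier hyperoctahedral_group" if "w \<in> carrier (hyperplane_group H)" for w
      using that by (simp add: hyperplane_group_def)
    then show "?R \<subseteq> ?L"
      using P key by (auto simp: zero_one_equiv_def simp del: split_paired_Ex)
  qed
  then show ?thesis
    by (auto simp: act signed_act_convex_hull)
qed

section \<open>Counting the classes\<close>

theorem theorem4p2:
  fixes H :: "(real ^ 'n::finite) set" and k :: nat
  assumes "CARD('n) \<ge> 2"
    and "2 ^ (CARD('n) - 2) < k" and "k \<le> 2 ^ (CARD('n) - 1)"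
    and "spanned_hyperplane H"
    and "card (vertices_in H) \<ge> k"
  shows "of_nat (num_partial_classes H k) =
    coeff_u1_u2 k (card (vertices_in H) - k) (hyperplane_C H)"
proof -
  interpret group_action "hyperplane_group H" "vertices_in H" "vertex_act H"
    by (rule group_action_vertex_act)
  define subsets where "subsets = {S. S \<subseteq> vertices_in H \<and> card S = k}"
  define orb where "orb S = {vertex_act H w ` S | w. w \<in> carrier (hyperplane_group H)}" for S
  \<comment> \<open>The lower bound on \<open>k\<close> makes \<open>k\<close> positive, hence these
    sets nonempty.\<close>
  have subsets: "S \<subseteq> cube_vertices" "S \<noteq> {}" "S \<subseteq> vertices_in H" "card S > 2 ^ (CARD('n) - 2)"
    "card S = k"
    if "S \<in> subsets" for S
    using that assms(2) by (auto simp: subsets_def vertices_in_def)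
  have hull_class: "zero_one_equiv H `` {convex hull S} = (hull) convex ` orb S"
    if "S \<in> subsets" for S
    unfolding orb_def using assms(1,4) subsets[OF that] by (intro partial_class_convex_hull)
  have orb_subsets: "orb S \<subseteq> subsets" if "S \<in> subsets" for S
  proof
    fix T assume "T \<in> orb S"
    then obtain w where w: "w \<in> carrier (hyperplane_group H)" "T = vertex_act H w ` S"
      by (auto simp: orb_def)
    then show "T \<in> subsets"
      using that surj_prop[of w] inj_prop[of w]
      by (auto simp: subsets_def card_image inj_on_subset)
  qed
  \<comment> \<open>The counted classes are exactly the sets of convex hulls of the members of one
    orbit of \<open>k\<close>-subsets.\<close>
  have "{C \<in> partial_classes H. \<forall>P \<in> C. zero_one_polytope_with k P} =
      (`) ((hull) convex) ` orb ` subsets"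
  proof safe
    fix C assume "C \<in> partial_classes H" and C: "\<forall>P \<in> C. zero_one_polytope_with k P"
    then obtain P where P: "P \<in> polytopes_in H" "C = zero_one_equiv H `` {P}"
      by (auto simp: partial_classes_def elim: quotientE)
    then have "P \<in> C"
      using equiv_class_self[OF equiv_zero_one_equiv] by blast
    with C obtain S where S: "S \<noteq> {}" "S \<subseteq> cube_vertices" "card S = k" "P = convex hull S"
      by (auto simp: zero_one_polytope_with_def)
    with P assms(4) have "S \<in> subsets"
      by (auto simp: subsets_def convex_hull_in_polytopes_in_iff)
    then show "C \<in> (`) ((hull) convex) ` orb ` subsets"
      using P(2) S(4) hull_class by blast
  next
    fix S assume S: "S \<in> subsets"
    have "convex hull S \<in> polytopes_in H"
      using assms(4) subsets[OF S] by (simp add: convex_hull_in_polytopes_in_iff)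
    then show "(hull) convex ` orb S \<in> partial_classes H"
      unfolding partial_classes_def hull_class[OF S, symmetric] by (rule quotientI)
  next
    fix S T assume "S \<in> subsets" "T \<in> orb S"
    then have "T \<in> subsets"
      using orb_subsets by blast
    then show "zero_one_polytope_with k (convex hull T)"
      unfolding zero_one_polytope_with_def using subsets[of T] by blast
  qed
  \<comment> \<open>Intersecting with the cube vertices recovers each set from its hull, so distinct
    orbits give distinct classes.\<close>
  moreover have "inj_on ((`) ((hull) convex)) (orb ` subsets)"
  proof (rule inj_on_subset)
    have "inj_on ((hull) convex) subsets"
      by (rule inj_on_inverseI[where g = "\<lambda>P. P \<inter> cube_vertices"])
         (simp add: convex_hull_inter_cube_vertices subsets)
    then show "inj_on ((`) ((hull) convex)) (Pow subsets)"
      by (rule inj_on_image_Pow)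
  qed (use orb_subsets in blast)
  ultimately have "num_partial_classes H k = card (orb ` subsets)"
    by (simp add: num_partial_classes_def card_image)
  also have "orb ` subsets = {orb S | S. S \<subseteq> vertices_in H \<and> card S = k}"
    by (auto simp: subsets_def)
  finally have "num_partial_classes H k =
      card {{vertex_act H w ` S | w. w \<in> carrier (hyperplane_group H)} | S.
        S \<subseteq> vertices_in H \<and> card S = k}"
    by (simp add: orb_def)
  moreover have "finite (carrier (hyperplane_group H))"
    by simp
  ultimately show ?thesis
    unfolding hyperplane_C_def hyperplane_cycle_index_def
    by (simp only: card_orbits_subsets finite_vertices_in)
qed

end
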